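(* Let $q$ be a prime power. For integers $1\le k\le n$, the number $f_{k,n}$ of $k\times n$ matrices $A$ over $\mathbf{F}_q$ of rank $k$ with $A_{ii}=0$ for all $1\le i\le k$ is $$f_{k,n}=q^{\binom{k-1}{2}}(q-1)^k\left(q^{-1}\sum_{i=0}^k(-1)^i\binom{k}{i}\frac{[n-i]_q!}{[n-k]_q!}\right).$$ In particular, the number of invertible $n\times n$ matrices over $\mathbf{F}_q$ with all diagonal entries equal to zero is $$f_{n,n}=q^{\binom{n-1}{2}}(q-1)^n\left(q^{-1}\sum_{i=0}^n(-1)^i\binom{n}{i}[n-i]_q!\right).$$
   Context: $\mathbf{F}_q$ is the field with $q$ elements. $[n]_q=\frac{q^n-1}{q-1}$ and $[n]_q!=[n]_q[n-1]_q\cdots[1]_q$, with $[0]_q!=1$. *)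

theory Defs
  imports Complex_Main "HOL-Library.Cardinality" "Jordan_Normal_Form.DL_Rank"
begin

definition q_bracket :: "real \<Rightarrow> nat \<Rightarrow> real" where
  "q_bracket q n = (q ^ n - 1) / (q - 1)"

definition q_factorial :: "real \<Rightarrow> nat \<Rightarrow> real" where
  "q_factorial q n = (\<Prod>j = 1..n. q_bracket q j)"

(* Matrix entries are indexed from 0.  The argument k of vec_space.rank is the
   dimension of the space containing the columns, that is, the number of rows. *)
definition zero_diag_full_rank_mats :: "nat \<Rightarrow> nat \<Rightarrow> 'a::field mat set" where
  "zero_diag_full_rank_mats k n =
     {A \<in> carrier_mat k n. vec_space.rank k A = k \<and> (\<forall>i<k. A $$ (i, i) = 0)}"

definition zero_diag_invertible_mats :: "nat \<Rightarrow> 'a::field mat set" where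
  "zero_diag_invertible_mats n =
     {A \<in> carrier_mat n n. invertible_mat A \<and> (\<forall>i<n. A $$ (i, i) = 0)}"

end

theory Submission
  imports Defs
begin

text \<open>
  The matrices are built one row at a time.  Let \<open>A\<close> be a \<open>k \<times> n\<close> matrix of rank \<open>k\<close> with zero
  diagonal, \<open>k < n\<close>.  A vector \<open>v\<close> may be added to \<open>A\<close> as row number \<open>k\<close> (counting from 0)
  exactly when \<open>v $ k = 0\<close> and \<open>v\<close> is outside the row space of \<open>A\<close>.  There are \<open>q\<^sup>n\<^sup>-\<^sup>1\<close> vectors
  with \<open>v $ k = 0\<close>.  Those in the row space are the combinations of the rows with
  coefficient vector \<open>c\<close> orthogonal to column \<open>k\<close> of \<open>A\<close>: they number \<open>q\<^sup>k\<close> if that column is zero,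
  and \<open>q\<^sup>k\<^sup>-\<^sup>1\<close> otherwise.  A matrix whose column \<open>k\<close> is zero is the same thing as a
  \<open>k \<times> (n - 1)\<close> matrix of the same kind, because deleting the column changes neither the rank
  nor the diagonal, whose \<open>k\<close> entries lie to the left of it.  Writing \<open>f k n\<close> for the number of matrices, this gives

  \<open>q * f (k + 1) n = (q\<^sup>n - q\<^sup>k) * f k n - (q\<^sup>k\<^sup>+\<^sup>1 - q\<^sup>k) * f k (n - 1)\<close>,

  which is \<open>zero_diag_full_rank_mats_recurrence\<close>.

  With \<open>S k n\<close> for the alternating sum of \<open>(k choose i) [n - i]!\<close>, Pascal's rule says
  \<open>S (k + 1) n = S k n - S k (n - 1)\<close>.  Since \<open>q\<^sup>n - q\<^sup>k = q\<^sup>k (q - 1) [n - k]\<close>, the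
  numbers \<open>q\<^sup>B (q - 1)\<^sup>k S k n / [n - k]!\<close>, where \<open>B = (k choose 2) - k\<close>, satisfy the same recurrence and the
  same initial condition \<open>f 0 n = 1\<close>.  The exponent \<open>B\<close> equals
  \<open>(k - 1 choose 2) - 1\<close> for \<open>k \<ge> 1\<close>.

  Full row rank is used throughout in the form "the transpose is injective", which
  \<open>rank_eq_dim_iff_transpose_inj\<close> derives from the definition by the column space; it is the
  instance of "row rank = column rank" that the argument depends on.
\<close>

section \<open>Full row rank as injectivity of the transpose\<close>

text \<open>
  If the columns span the whole space, a vector orthogonal to all of them is orthogonal to every
  unit vector, hence zero.  Conversely, suppose that a maximal independent set \<open>U\<close> of columns has
  fewer than \<open>n\<close> elements.  Written as rows and padded by zero rows, they form a singular square
  matrix.  A nonzero kernel vector of it is orthogonal to \<open>U\<close>, hence to all columns, which lie in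
  \<open>span U\<close> by maximality.
\<close>

lemma (in vec_space) rank_eq_dim_iff_transpose_inj:
  assumes A: "A \<in> carrier_mat n m"
  shows "rank A = n \<longleftrightarrow> (\<forall>c\<in>carrier_vec n. A\<^sup>T *\<^sub>v c = 0\<^sub>v m \<longrightarrow> c = 0\<^sub>v n)"
proof -
  obtain U where max: "maximal U (\<lambda>T. T \<subseteq> set (cols A) \<and> lin_indpt T)" and fin: "finite U"
    using maximal_exists_superset[of "set (cols A)" "\<lambda>T. T \<subseteq> set (cols A) \<and> lin_indpt T" "{}"]
    by (auto simp: finite_lin_indpt2)
  have rank: "rank A = card U" by (rule rank_card_indpt[OF A max])
  have U: "U \<subseteq> set (cols A)" "lin_indpt U" using max by (auto simp: maximal_def)
  have cols: "set (cols A) \<subseteq> carrier_vec n" using A cols_dim by blast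
  then have Uc: "U \<subseteq> carrier_vec n" using U by auto
  have span: "c \<in> span U" if "c \<in> set (cols A)" for c
  proof (cases "c \<in> U")
    case True then show ?thesis using Uc in_own_span[of U] by auto
  next
    case False
    have "\<not> lin_indpt (U \<union> {c})"
    proof
      assume "lin_indpt (U \<union> {c})"
      then have "U = U \<union> {c}"
        using max that U unfolding maximal_def by (metis Un_upper1 empty_subsetI insert_subset le_sup_iff)
      then show False using False by auto
    qed
    then show ?thesis using lin_dep_iff_in_span[of U c] Uc U False that cols by auto
  qed
  \<comment> \<open>The matrix \<open>B\<close> with column set \<open>U\<close> describes \<open>span U\<close> as an image, so that
    orthogonality to \<open>span U\<close> becomes \<open>B\<^sup>T *\<^sub>v c = 0\<close>.\<close>
  obtain us where us: "set us = U" "distinct us" using finite_distinct_list[OF fin] by auto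
  have len: "length us = card U" using us distinct_card by fastforce
  define B where "B = mat_of_cols n us"
  have B: "B \<in> carrier_mat n (card U)" by (simp add: B_def len[symmetric])
  have colsB: "cols B = us" unfolding B_def using us Uc by (intro cols_mat_of_cols) auto
  have spanU: "span U = {y. \<exists>x\<in>carrier_vec (card U). B *\<^sub>v x = y}"
    using col_space_eq[OF B] B unfolding col_space_def colsB us by auto
  show ?thesis
  proof
    assume r: "rank A = n"
    have "basis U" using fin Uc U r rank by (intro dim_li_is_basis) (auto simp: dim_is_n)
    then have gen: "span U = carrier_vec n" unfolding basis_def by simp
    show "\<forall>c\<in>carrier_vec n. A\<^sup>T *\<^sub>v c = 0\<^sub>v m \<longrightarrow> c = 0\<^sub>v n"
    proof (intro ballI impI)
      fix c assume c: "c \<in> carrier_vec n" and Ac: "A\<^sup>T *\<^sub>v c = 0\<^sub>v m"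
      show "c = 0\<^sub>v n"
      proof (rule eq_vecI)
        fix i assume "i < dim_vec (0\<^sub>v n :: 'a vec)"
        then have i: "i < n" by simp
        then have "unit_vec n i \<in> span (set (cols A))"
          using gen span_is_monotone[OF U(1)] by auto
        then obtain x where x: "x \<in> carrier_vec m" "A *\<^sub>v x = unit_vec n i"
          using col_space_eq[OF A] A unfolding col_space_def by auto
        have "c $ i = c \<bullet> unit_vec n i" using c i by simp
        also have "\<dots> = (A\<^sup>T *\<^sub>v c) \<bullet> x"
          using transpose_vec_mult_scalar[OF A x(1) c] x(2) by simp
        finally show "c $ i = 0\<^sub>v n $ i" using Ac x i by simp
      qed (use c in simp)
    qed
  next
    assume inj: "\<forall>c\<in>carrier_vec n. A\<^sup>T *\<^sub>v c = 0\<^sub>v m \<longrightarrow> c = 0\<^sub>v n"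
    have le: "card U \<le> n" using li_le_dim(2)[of U] Uc U dim_is_n by simp
    have "\<not> card U < n"
    proof
      assume less: "card U < n"
      define M where "M = mat\<^sub>r n n (\<lambda>i. if i < card U then us ! i else 0\<^sub>v n)"
      have M: "M \<in> carrier_mat n n" by (simp add: M_def)
      have usc: "us ! i \<in> carrier_vec n" if "i < card U" for i
        using that us len Uc by (metis nth_mem subsetD)
      \<comment> \<open>The rewritten form exhibits the first padding row, number \<open>card U\<close>, as zero.\<close>
      have "M = mat\<^sub>r n n (\<lambda>i. if i = card U then 0\<^sub>v n else if i < card U then us ! i else 0\<^sub>v n)"
        unfolding M_def by (rule arg_cong[where f = "mat\<^sub>r n n"]) auto
      also have "det \<dots> = 0" using less usc by (intro det_row_0) auto
      finally obtain c where c: "c \<in> carrier_vec n" "c \<noteq> 0\<^sub>v n" "M *\<^sub>v c = 0\<^sub>v n"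
        using det_0_iff_vec_prod_zero_field[OF M] by auto
      have Bc: "B\<^sup>T *\<^sub>v c = 0\<^sub>v (card U)"
      proof (rule eq_vecI)
        fix i assume "i < dim_vec (0\<^sub>v (card U) :: 'a vec)"
        then have i: "i < card U" by simp
        then have "col B i = us ! i" using colsB B by (metis carrier_matD(2) cols_nth)
        moreover have "row M i = us ! i" using i less usc unfolding M_def by simp
        ultimately show "(B\<^sup>T *\<^sub>v c) $ i = 0\<^sub>v (card U) $ i"
          using i less B M arg_cong[OF c(3), of "\<lambda>v. v $ i"] by simp
      qed (use B in simp)
      have "A\<^sup>T *\<^sub>v c = 0\<^sub>v m"
      proof (rule eq_vecI)
        fix j assume "j < dim_vec (0\<^sub>v m :: 'a vec)"
        then have j: "j < m" by simp
        then have "col A j \<in> span U" using A by (intro span) (auto simp: cols_def)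
        then obtain x where x: "x \<in> carrier_vec (card U)" "B *\<^sub>v x = col A j"
          unfolding spanU by auto
        have "(A\<^sup>T *\<^sub>v c) $ j = col A j \<bullet> c" using A j by simp
        also have "\<dots> = c \<bullet> (B *\<^sub>v x)" using A c x comm_scalar_prod[of "col A j" n c] j by simp
        also have "\<dots> = (B\<^sup>T *\<^sub>v c) \<bullet> x"
          using transpose_vec_mult_scalar[OF B x(1) c(1)] by simp
        finally show "(A\<^sup>T *\<^sub>v c) $ j = 0\<^sub>v m $ j" using Bc x j by simp
      qed (use A in simp)
      then show False using inj c by auto
    qed
    then show "rank A = n" using le rank by simp
  qed
qed


section \<open>Counting vectors over a finite field\<close>

lemma finite_carrier_vec: "finite (carrier_vec n :: 'a::finite vec set)"
  and card_carrier_vec: "card (carrier_vec n :: 'a::finite vec set) = CARD('a) ^ n"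
proof -
  have "bij_betw vec_of_list {xs :: 'a list. length xs = n} (carrier_vec n)"
    by (rule bij_betw_byWitness[where f' = list_of_vec]) (auto simp: list_vec vec_list intro: carrier_vecI)
  then have b: "bij_betw vec_of_list {xs :: 'a list. set xs \<subseteq> UNIV \<and> length xs = n} (carrier_vec n)"
    by simp
  show "finite (carrier_vec n :: 'a vec set)"
    using bij_betw_finite[OF b] finite_lists_length_eq[of "UNIV :: 'a set"] by simp
  show "card (carrier_vec n :: 'a vec set) = CARD('a) ^ n"
    using bij_betw_same_card[OF b] card_lists_length_eq[of "UNIV :: 'a set"] by simp
qed

text \<open>
  The level sets of \<open>c \<mapsto> u \<bullet> c\<close> are translates of each other, so each of the \<open>CARD('a)\<close> levels has
  the same share of the space.  Multiplying out avoids the exponent \<open>n - 1\<close>.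
\<close>
lemma card_hyperplane:
  fixes u :: "'a::{field,finite} vec"
  assumes u: "u \<in> carrier_vec n" "u \<noteq> 0\<^sub>v n"
  shows "CARD('a) * card {c \<in> carrier_vec n. u \<bullet> c = 0} = CARD('a) ^ n"
proof -
  define H where "H a = {c \<in> carrier_vec n. u \<bullet> c = a}" for a
  obtain i where i: "i < n" "u $ i \<noteq> 0"
    using u by (metis carrier_vecD eq_vecI index_zero_vec)
  have eq: "card (H a) = card (H 0)" for a
  proof -
    define w where "w = (a / u $ i) \<cdot>\<^sub>v unit_vec n i"
    have w: "w \<in> carrier_vec n" "u \<bullet> w = a" using u i by (auto simp: w_def)
    have "bij_betw (\<lambda>c. c + w) (H 0) (H a)"
    proof (rule bij_betw_byWitness[where f' = "\<lambda>c. c - w"])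
      show "(\<lambda>c. c + w) ` H 0 \<subseteq> H a"
        using u w by (auto simp: H_def scalar_prod_add_distrib[of _ n])
      show "(\<lambda>c. c - w) ` H a \<subseteq> H 0"
        using u w by (auto simp: H_def scalar_prod_minus_distrib[of _ n])
    qed (use w in \<open>auto simp: H_def\<close>)
    then show ?thesis using bij_betw_same_card by fastforce
  qed
  have "card (\<Union>a. H a) = (\<Sum>a\<in>UNIV. card (H a))"
    by (rule card_UN_disjoint) (auto simp: H_def finite_carrier_vec)
  moreover have "(\<Union>a. H a) = carrier_vec n" by (auto simp: H_def)
  moreover have "(\<Sum>a\<in>UNIV. card (H a)) = (\<Sum>a\<in>(UNIV :: 'a set). card (H 0))"
    by (intro sum.cong refl eq)
  ultimately have "CARD('a) ^ n = (\<Sum>a\<in>(UNIV :: 'a set). card (H 0))"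
    by (simp only: card_carrier_vec)
  then show ?thesis by (simp add: H_def)
qed

lemma zero_diag_full_rank_mats_eq:
  "zero_diag_full_rank_mats k n = {A \<in> carrier_mat k n.
     (\<forall>c\<in>carrier_vec k. A\<^sup>T *\<^sub>v c = 0\<^sub>v n \<longrightarrow> c = 0\<^sub>v k) \<and> (\<forall>i<k. A $$ (i, i) = 0)}"
  unfolding zero_diag_full_rank_mats_def
  by (auto simp: vec_space.rank_eq_dim_iff_transpose_inj)

lemma finite_carrier_mat: "finite (carrier_mat k n :: 'a::finite mat set)"
proof (rule inj_on_finite)
  show "inj_on rows (carrier_mat k n :: 'a mat set)"
    by (intro inj_on_inverseI[where g = "mat_of_rows n"]) auto
  show "rows ` (carrier_mat k n :: 'a mat set) \<subseteq> {vs. set vs \<subseteq> carrier_vec n \<and> length vs = k}"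
    by (auto simp: rows_def)
qed (simp add: finite_lists_length_eq finite_carrier_vec)

section \<open>Adding a row\<close>

definition snoc_row :: "'a mat \<Rightarrow> 'a vec \<Rightarrow> 'a mat" where
  "snoc_row A v = mat (Suc (dim_row A)) (dim_col A)
     (\<lambda>(i, j). if i < dim_row A then A $$ (i, j) else v $ j)"

definition snoc_vec :: "'a vec \<Rightarrow> 'a \<Rightarrow> 'a vec" where
  "snoc_vec c a = vec (Suc (dim_vec c)) (\<lambda>i. if i < dim_vec c then c $ i else a)"

lemma snoc_row_transpose_mult:
  assumes A: "A \<in> carrier_mat k n" and v: "v \<in> carrier_vec n" and c: "c \<in> carrier_vec k"
  shows "(snoc_row A v)\<^sup>T *\<^sub>v snoc_vec c a = A\<^sup>T *\<^sub>v c + a \<cdot>\<^sub>v (v :: 'a::field vec)"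
proof (rule eq_vecI)
  fix j assume "j < dim_vec (A\<^sup>T *\<^sub>v c + a \<cdot>\<^sub>v v)"
  then have j: "j < n" using v by simp
  have "(\<Sum>i<Suc k. col (snoc_row A v) j $ i * snoc_vec c a $ i)
      = (\<Sum>i<k. col A j $ i * c $ i) + v $ j * a"
    using A v c j by (simp add: snoc_row_def snoc_vec_def)
  then show "((snoc_row A v)\<^sup>T *\<^sub>v snoc_vec c a) $ j = (A\<^sup>T *\<^sub>v c + a \<cdot>\<^sub>v v) $ j"
    using A v c j
    by (simp add: scalar_prod_def snoc_row_def snoc_vec_def atLeast0LessThan del: sum.lessThan_Suc)
qed (use A v in \<open>auto simp: snoc_row_def\<close>)

lemma snoc_vec_cases:
  assumes "c \<in> carrier_vec (Suc k)"
  obtains c' a where "c' \<in> carrier_vec k" "c = snoc_vec c' a"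
proof
  show "vec k (\<lambda>i. c $ i) \<in> carrier_vec k" by simp
  show "c = snoc_vec (vec k (\<lambda>i. c $ i)) (c $ k)"
    using assms by (intro eq_vecI) (auto simp: snoc_vec_def less_Suc_eq)
qed

lemma snoc_vec_eq_zero_iff:
  "snoc_vec c a = 0\<^sub>v (Suc k) \<longleftrightarrow> c = 0\<^sub>v k \<and> a = 0"
  if "c \<in> carrier_vec k"
proof
  assume e: "snoc_vec c a = 0\<^sub>v (Suc k)"
  have "(if i < k then c $ i else a) = 0" if "i < Suc k" for i
    using arg_cong[OF e, of "\<lambda>v. v $ i"] \<open>c \<in> carrier_vec k\<close> that by (simp add: snoc_vec_def)
  then show "c = 0\<^sub>v k \<and> a = 0" using that by (intro conjI eq_vecI) (force split: if_splits)+
qed (auto simp: snoc_vec_def)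


text \<open>
  A relation among the rows of the enlarged matrix is \<open>A\<^sup>T *\<^sub>v c + a \<cdot>\<^sub>v v = 0\<close>.  If \<open>a \<noteq> 0\<close>, it can
  be solved for \<open>v\<close>, so \<open>v\<close> is in the row space of \<open>A\<close>; otherwise it is a relation among the rows of \<open>A\<close>.
\<close>
lemma snoc_row_transpose_inj_iff:
  fixes A :: "'a::field mat"
  assumes A: "A \<in> carrier_mat k n" and v: "v \<in> carrier_vec n"
  shows "(\<forall>c\<in>carrier_vec (Suc k). (snoc_row A v)\<^sup>T *\<^sub>v c = 0\<^sub>v n \<longrightarrow> c = 0\<^sub>v (Suc k)) \<longleftrightarrow>
    (\<forall>c\<in>carrier_vec k. A\<^sup>T *\<^sub>v c = 0\<^sub>v n \<longrightarrow> c = 0\<^sub>v k) \<and> v \<notin> (*\<^sub>v) A\<^sup>T ` carrier_vec k"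
    (is "?L \<longleftrightarrow> ?R \<and> ?N")
proof -
  have zero: "0 \<cdot>\<^sub>v v = 0\<^sub>v n" using v by (intro eq_vecI) auto
  show ?thesis
  proof (intro iffI conjI)
    have carrier: "snoc_vec c a \<in> carrier_vec (Suc k)" if "c \<in> carrier_vec k" for c :: "'a vec" and a
      using that by (simp add: snoc_vec_def)
    assume L: ?L
    have L': "c = 0\<^sub>v k \<and> a = 0" if "c \<in> carrier_vec k" "A\<^sup>T *\<^sub>v c + a \<cdot>\<^sub>v v = 0\<^sub>v n" for c a
      using L carrier[OF that(1)] that(2) snoc_row_transpose_mult[OF A v that(1)]
        snoc_vec_eq_zero_iff[OF that(1)] by metis
    show ?R
    proof (intro ballI impI)
      fix c assume "c \<in> carrier_vec k" "A\<^sup>T *\<^sub>v c = 0\<^sub>v n"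
      then show "c = 0\<^sub>v k" using L'[of c 0] zero by auto
    qed
    show ?N
    proof
      assume "v \<in> (*\<^sub>v) A\<^sup>T ` carrier_vec k"
      then obtain c where c: "c \<in> carrier_vec k" "v = A\<^sup>T *\<^sub>v c" by auto
      have "v + (- 1) \<cdot>\<^sub>v v = 0\<^sub>v n" using v by (intro eq_vecI) auto
      then show False using L'[of c "-1"] c by auto
    qed
  next
    assume RN: "?R \<and> ?N"
    show ?L
    proof (intro ballI impI)
      fix d assume "d \<in> carrier_vec (Suc k)" and d0: "(snoc_row A v)\<^sup>T *\<^sub>v d = 0\<^sub>v n"
      then obtain c a where c: "c \<in> carrier_vec k" and d: "d = snoc_vec c a"
        by (elim snoc_vec_cases)
      have e: "A\<^sup>T *\<^sub>v c + a \<cdot>\<^sub>v v = 0\<^sub>v n"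
        using d0 snoc_row_transpose_mult[OF A v c] d by simp
      have "a = 0"
      proof (rule ccontr)
        assume a: "a \<noteq> 0"
        have "v = A\<^sup>T *\<^sub>v ((- 1 / a) \<cdot>\<^sub>v c)"
        proof (rule eq_vecI)
          fix j assume "j < dim_vec (A\<^sup>T *\<^sub>v ((- 1 / a) \<cdot>\<^sub>v c))"
          then have j: "j < n" using A by simp
          have "col A j \<bullet> c + a * v $ j = 0"
            using arg_cong[OF e, of "\<lambda>w. w $ j"] A v j by simp
          then show "v $ j = (A\<^sup>T *\<^sub>v ((- 1 / a) \<cdot>\<^sub>v c)) $ j"
            using a A c j by (simp add: field_simps add_eq_0_iff)
        qed (use A v in auto)
        then show False using RN c by (auto intro: imageI)
      qed
      then show "d = 0\<^sub>v (Suc k)" using e RN c A d snoc_vec_eq_zero_iff[OF c] zero by auto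
    qed
  qed
qed

lemma zero_diag_full_rank_mats_Suc:
  assumes "k < n"
  shows "bij_betw (\<lambda>(A, v). snoc_row A v)
    (SIGMA A:zero_diag_full_rank_mats k n.
      {v \<in> carrier_vec n. v $ k = 0} - (*\<^sub>v) A\<^sup>T ` carrier_vec k)
    (zero_diag_full_rank_mats (Suc k) n :: 'a::field mat set)"
    (is "bij_betw ?f ?S ?T")
proof (rule bij_betw_byWitness[where f' = "\<lambda>B. (mat k n (\<lambda>ij. B $$ ij), row B k)"])
  let ?g = "\<lambda>B :: 'a mat. (mat k n (\<lambda>ij. B $$ ij), row B k)"
  have inv1: "?g (snoc_row A v) = (A, v)" if "A \<in> carrier_mat k n" "v \<in> carrier_vec n" for A v
    using that by (auto simp: snoc_row_def)
  have inv2: "?f (?g B) = B" if "B \<in> carrier_mat (Suc k) n" for B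
    using that by (auto simp: snoc_row_def less_Suc_eq)
  show "\<forall>p\<in>?S. ?g (?f p) = p" using inv1 by (auto simp: zero_diag_full_rank_mats_eq)
  show "\<forall>B\<in>?T. ?f (?g B) = B" using inv2 by (auto simp: zero_diag_full_rank_mats_eq)
  have mem: "snoc_row A v \<in> ?T \<longleftrightarrow> (A, v) \<in> ?S"
    if A: "A \<in> carrier_mat k n" and v: "v \<in> carrier_vec n" for A v
  proof -
    have "snoc_row A v \<in> carrier_mat (Suc k) n" using A by (simp add: snoc_row_def)
    moreover have "(\<forall>i<Suc k. snoc_row A v $$ (i, i) = 0) \<longleftrightarrow> (\<forall>i<k. A $$ (i, i) = 0) \<and> v $ k = 0"
      using A \<open>k < n\<close> by (auto simp: snoc_row_def less_Suc_eq)
    ultimately show ?thesis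
      using snoc_row_transpose_inj_iff[OF A v] A v
      unfolding zero_diag_full_rank_mats_eq by blast
  qed
  show "?f ` ?S \<subseteq> ?T"
  proof clarify
    fix A :: "'a mat" and v assume "A \<in> zero_diag_full_rank_mats k n" "v \<in> carrier_vec n" "v $ k = 0"
      "v \<notin> (*\<^sub>v) A\<^sup>T ` carrier_vec k"
    then show "snoc_row A v \<in> ?T"
      by (subst mem) (auto simp: zero_diag_full_rank_mats_def)
  qed
  show "?g ` ?T \<subseteq> ?S"
  proof
    fix p assume "p \<in> ?g ` ?T"
    then obtain B where B: "B \<in> ?T" "p = ?g B" by auto
    have Bc: "B \<in> carrier_mat (Suc k) n" using B by (simp add: zero_diag_full_rank_mats_eq)
    have "snoc_row (fst p) (snd p) \<in> ?T" using inv2[OF Bc] B by simp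
    moreover have "fst p \<in> carrier_mat k n" "snd p \<in> carrier_vec n" using B Bc by auto
    ultimately have "(fst p, snd p) \<in> ?S" by (simp only: mem)
    then show "p \<in> ?S" by (simp only: prod.collapse)
  qed
qed

text \<open>
  The map \<open>c \<mapsto> A\<^sup>T *\<^sub>v c\<close> is injective, and entry \<open>k\<close> of its value is \<open>col A k \<bullet> c\<close>.  So the vectors of the row
  space with entry \<open>k\<close> zero are counted by the \<open>c\<close> orthogonal to \<open>col A k\<close>, which form a hyperplane
  or, if \<open>col A k\<close> is zero, the whole space.
\<close>
lemma card_new_rows:
  fixes A :: "'a::{field,finite} mat"
  assumes A: "A \<in> zero_diag_full_rank_mats k n" and k: "k < n"
  shows "real CARD('a) * real (card ({v \<in> carrier_vec n. v $ k = 0} - (*\<^sub>v) A\<^sup>T ` carrier_vec k)) =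
    real CARD('a) ^ n - real CARD('a) ^ k -
      (if col A k = 0\<^sub>v k then real CARD('a) ^ Suc k - real CARD('a) ^ k else 0)"
proof -
  let ?V = "{v \<in> carrier_vec n. v $ k = (0 :: 'a)}"
  let ?C = "{c \<in> carrier_vec k. col A k \<bullet> c = 0}"
  have Ac: "A \<in> carrier_mat k n"
    and ker: "\<And>c. c \<in> carrier_vec k \<Longrightarrow> A\<^sup>T *\<^sub>v c = 0\<^sub>v n \<Longrightarrow> c = 0\<^sub>v k"
    using A by (auto simp: zero_diag_full_rank_mats_eq)
  have inj: "inj_on ((*\<^sub>v) A\<^sup>T) (carrier_vec k)"
  proof (rule inj_onI)
    fix c d assume c: "c \<in> carrier_vec k" and d: "d \<in> carrier_vec k" and e: "A\<^sup>T *\<^sub>v c = A\<^sup>T *\<^sub>v d"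
    have "A\<^sup>T *\<^sub>v (c - d) = 0\<^sub>v n"
      using Ac c d e mult_minus_distrib_mat_vec[of "A\<^sup>T" n k c d] by simp
    then have diff: "c - d = 0\<^sub>v k" using ker c d by simp
    show "c = d"
    proof (rule eq_vecI)
      fix i assume "i < dim_vec d"
      then show "c $ i = d $ i" using arg_cong[OF diff, of "\<lambda>v. v $ i"] c d by auto
    qed (use c d in simp)
  qed
  have "?V - (*\<^sub>v) A\<^sup>T ` carrier_vec k = ?V - (*\<^sub>v) A\<^sup>T ` ?C" and sub: "(*\<^sub>v) A\<^sup>T ` ?C \<subseteq> ?V"
    using Ac k by auto
  moreover have "card ((*\<^sub>v) A\<^sup>T ` ?C) = card ?C"
    by (intro card_image inj_on_subset[OF inj]) auto
  moreover have fin: "finite ?V" by (rule finite_subset[OF _ finite_carrier_vec]) auto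
  moreover have "card ((*\<^sub>v) A\<^sup>T ` ?C) \<le> card ?V" by (rule card_mono[OF fin sub])
  ultimately have diff: "real (card (?V - (*\<^sub>v) A\<^sup>T ` carrier_vec k)) = real (card ?V) - real (card ?C)"
    by (simp add: card_Diff_subset finite_subset of_nat_diff)
  have "?V = {c \<in> carrier_vec n. unit_vec n k \<bullet> c = 0}"
    using k by auto
  then have V: "real CARD('a) * real (card ?V) = real CARD('a) ^ n"
    using card_hyperplane[of "unit_vec n k :: 'a vec" n] k
    by (metis of_nat_mult of_nat_power unit_vec_carrier unit_vec_nonzero)
  have C: "real CARD('a) * real (card ?C) = (if col A k = 0\<^sub>v k then real CARD('a) ^ Suc k else real CARD('a) ^ k)"
  proof (cases "col A k = 0\<^sub>v k")
    case True
    then have "?C = carrier_vec k" by auto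
    then show ?thesis using True by (simp add: card_carrier_vec)
  next
    case False
    moreover have "col A k \<in> carrier_vec k" using Ac k by auto
    ultimately have "CARD('a) * card ?C = CARD('a) ^ k" by (intro card_hyperplane)
    then have "real (CARD('a) * card ?C) = real (CARD('a) ^ k)" by (rule arg_cong)
    then show ?thesis using False by simp
  qed
  show ?thesis unfolding diff right_diff_distrib V C by simp
qed

section \<open>Removing a zero column\<close>

definition insert_zero_col :: "nat \<Rightarrow> 'a::zero mat \<Rightarrow> 'a mat" where
  "insert_zero_col k A = mat (dim_row A) (Suc (dim_col A))
     (\<lambda>(i, j). if j < k then A $$ (i, j) else if j = k then 0 else A $$ (i, j - 1))"

definition delete_col :: "nat \<Rightarrow> 'a mat \<Rightarrow> 'a mat" where
  "delete_col k B = mat (dim_row B) (dim_col B - 1)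
     (\<lambda>(i, j). if j < k then B $$ (i, j) else B $$ (i, Suc j))"

lemma transpose_mult_insert_zero_col:
  fixes A :: "'a::field mat"
  assumes A: "A \<in> carrier_mat r m" and c: "c \<in> carrier_vec r" and k: "k \<le> m"
  shows "(insert_zero_col k A)\<^sup>T *\<^sub>v c = 0\<^sub>v (Suc m) \<longleftrightarrow> A\<^sup>T *\<^sub>v c = 0\<^sub>v m" (is "?L \<longleftrightarrow> ?R")
proof -
  let ?B = "insert_zero_col k A"
  have col: "col ?B j = (if j < k then col A j else if j = k then 0\<^sub>v r else col A (j - 1))"
    if "j < Suc m" for j
    using that A k by (intro eq_vecI) (auto simp: insert_zero_col_def)
  have B: "?B \<in> carrier_mat r (Suc m)" using A by (simp add: insert_zero_col_def)
  have L: "?L \<longleftrightarrow> (\<forall>j<Suc m. col ?B j \<bullet> c = 0)" using B c by (auto simp: vec_eq_iff)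
  have R: "?R \<longleftrightarrow> (\<forall>j<m. col A j \<bullet> c = 0)" using A c by (auto simp: vec_eq_iff)
  show ?thesis unfolding L R
  proof (intro iffI allI impI)
    fix j assume "\<forall>j<Suc m. col ?B j \<bullet> c = 0" and j: "j < m"
    then have "col ?B (if j < k then j else Suc j) \<bullet> c = 0" by simp
    then show "col A j \<bullet> c = 0" using col[of j] col[of "Suc j"] j by (simp split: if_splits)
  next
    fix j assume "\<forall>j<m. col A j \<bullet> c = 0" and "j < Suc m"
    then show "col ?B j \<bullet> c = 0" using col[of j] k c by auto
  qed
qed

text \<open>
  The bound \<open>k \<le> m\<close> says that the column is inserted to the right of all the diagonal positions
  \<open>(i, i)\<close> with \<open>i < k\<close>, so the diagonal condition carries over unchanged.
\<close>
lemma card_zero_diag_full_rank_mats_zero_col: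
  assumes "k \<le> m"
  shows "card {B \<in> zero_diag_full_rank_mats k (Suc m). col B k = (0\<^sub>v k :: 'a::field vec)} =
    card (zero_diag_full_rank_mats k m :: 'a mat set)"
proof -
  have mem: "insert_zero_col k A \<in> zero_diag_full_rank_mats k (Suc m) \<longleftrightarrow> A \<in> zero_diag_full_rank_mats k m"
    if A: "A \<in> carrier_mat k m" for A :: "'a mat"
  proof -
    have "insert_zero_col k A \<in> carrier_mat k (Suc m)" using A by (simp add: insert_zero_col_def)
    moreover have "(\<forall>i<k. insert_zero_col k A $$ (i, i) = 0) \<longleftrightarrow> (\<forall>i<k. A $$ (i, i) = 0)"
      using A assms by (auto simp: insert_zero_col_def)
    ultimately show ?thesis
      using transpose_mult_insert_zero_col[OF A _ assms] A
      by (auto simp: zero_diag_full_rank_mats_eq)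
  qed
  have inv: "insert_zero_col k (delete_col k B) = B"
    if B: "B \<in> carrier_mat k (Suc m)" and z: "col B k = 0\<^sub>v k" for B :: "'a mat"
  proof (rule eq_matI)
    fix i j assume ij: "i < dim_row B" "j < dim_col B"
    then have "B $$ (i, k) = 0" using arg_cong[OF z, of "\<lambda>v. v $ i"] B assms by auto
    then show "insert_zero_col k (delete_col k B) $$ (i, j) = B $$ (i, j)"
      using ij B assms by (auto simp: insert_zero_col_def delete_col_def)
  qed (use B in \<open>auto simp: insert_zero_col_def delete_col_def\<close>)
  have "bij_betw (insert_zero_col k) (zero_diag_full_rank_mats k m :: 'a mat set)
    {B \<in> zero_diag_full_rank_mats k (Suc m). col B k = 0\<^sub>v k}"
  proof (rule bij_betw_byWitness[where f' = "delete_col k"])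
    show "\<forall>A\<in>zero_diag_full_rank_mats k m. delete_col k (insert_zero_col k A) = (A :: 'a mat)"
      by (auto simp: zero_diag_full_rank_mats_eq insert_zero_col_def delete_col_def)
    show "\<forall>B\<in>{B \<in> zero_diag_full_rank_mats k (Suc m). col B k = 0\<^sub>v k}.
        insert_zero_col k (delete_col k B) = (B :: 'a mat)"
      using inv by (auto simp: zero_diag_full_rank_mats_eq)
    show "insert_zero_col k ` (zero_diag_full_rank_mats k m :: 'a mat set) \<subseteq>
        {B \<in> zero_diag_full_rank_mats k (Suc m). col B k = 0\<^sub>v k}"
    proof clarify
      fix A :: "'a mat" assume A: "A \<in> zero_diag_full_rank_mats k m"
      then have Ac: "A \<in> carrier_mat k m" by (simp add: zero_diag_full_rank_mats_eq)
      then have "col (insert_zero_col k A) k = 0\<^sub>v k"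
        using assms by (intro eq_vecI) (auto simp: insert_zero_col_def)
      then show "insert_zero_col k A \<in> zero_diag_full_rank_mats k (Suc m) \<and>
          col (insert_zero_col k A) k = 0\<^sub>v k" using mem[OF Ac] A by simp
    qed
    show "delete_col k ` {B \<in> zero_diag_full_rank_mats k (Suc m). col B k = 0\<^sub>v k} \<subseteq>
        (zero_diag_full_rank_mats k m :: 'a mat set)"
    proof clarify
      fix B :: "'a mat" assume B: "B \<in> zero_diag_full_rank_mats k (Suc m)" "col B k = 0\<^sub>v k"
      then have Bc: "B \<in> carrier_mat k (Suc m)" by (simp add: zero_diag_full_rank_mats_eq)
      then have "delete_col k B \<in> carrier_mat k m" by (simp add: delete_col_def)
      then show "delete_col k B \<in> zero_diag_full_rank_mats k m" using mem inv[OF Bc B(2)] B(1) by metis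
    qed
  qed
  then show ?thesis using bij_betw_same_card by fastforce
qed

section \<open>The recurrence and its solution\<close>

lemma zero_diag_full_rank_mats_recurrence:
  fixes q :: real
  defines "q \<equiv> real CARD('a::{field,finite})"
  assumes "k \<le> m"
  shows "q * real (card (zero_diag_full_rank_mats (Suc k) (Suc m) :: 'a mat set)) =
    (q ^ Suc m - q ^ k) * real (card (zero_diag_full_rank_mats k (Suc m) :: 'a mat set)) -
    (q ^ Suc k - q ^ k) * real (card (zero_diag_full_rank_mats k m :: 'a mat set))"
proof -
  let ?Z = "zero_diag_full_rank_mats k (Suc m) :: 'a mat set"
  let ?N = "\<lambda>A. {v \<in> carrier_vec (Suc m). v $ k = 0} - (*\<^sub>v) A\<^sup>T ` carrier_vec k"
  have fin: "finite ?Z"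
    by (rule finite_subset[OF _ finite_carrier_mat]) (auto simp: zero_diag_full_rank_mats_def)
  have "card (zero_diag_full_rank_mats (Suc k) (Suc m) :: 'a mat set) = (\<Sum>A\<in>?Z. card (?N A))"
    using bij_betw_same_card[OF zero_diag_full_rank_mats_Suc[of k "Suc m", where 'a = 'a]] assms fin
    by (simp add: finite_carrier_vec)
  then have "q * real (card (zero_diag_full_rank_mats (Suc k) (Suc m) :: 'a mat set))
      = (\<Sum>A\<in>?Z. q * real (card (?N A)))" by (simp add: sum_distrib_left)
  also have "\<dots> = (\<Sum>A\<in>?Z. q ^ Suc m - q ^ k - (if col A k = 0\<^sub>v k then q ^ Suc k - q ^ k else 0))"
    unfolding q_def using assms by (intro sum.cong refl card_new_rows) auto
  also have "\<dots> = (q ^ Suc m - q ^ k) * real (card ?Z)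
      - (q ^ Suc k - q ^ k) * real (card {A \<in> ?Z. col A k = 0\<^sub>v k})"
    using fin by (simp add: sum_subtractf sum.If_cases Int_def mult.commute del: power_Suc)
  finally show ?thesis unfolding card_zero_diag_full_rank_mats_zero_col[OF \<open>k \<le> m\<close>] .
qed

lemma one_less_card_field: "1 < CARD('a::{field,finite})"
proof -
  have "card {0, 1 :: 'a} \<le> CARD('a)" by (rule card_mono) auto
  then show ?thesis by simp
qed

lemma q_factorial_Suc: "q_factorial q (Suc n) = q_bracket q (Suc n) * q_factorial q n"
  by (simp add: q_factorial_def)

lemma q_factorial_nonzero:
  assumes "q > 1"
  shows "q_factorial q n \<noteq> 0"
proof -
  have "1 < q ^ j" if "j \<in> {1..n}" for j
    using assms that by (intro one_less_power) auto
  then have "q ^ j \<noteq> 1" if "j \<in> {1..n}" for j using that by fastforce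
  then show ?thesis using assms by (auto simp: q_factorial_def q_bracket_def)
qed

text \<open>
  Pascal's rule: \<open>k + 1\<close> finite differences of \<open>g\<close> at 0 are \<open>k\<close> differences of \<open>g\<close> minus those of
  its shift.
\<close>
lemma alternating_binomial_sum_Suc:
  fixes g :: "nat \<Rightarrow> real"
  shows "(\<Sum>i\<le>Suc k. (-1) ^ i * real (Suc k choose i) * g i) =
    (\<Sum>i\<le>k. (-1) ^ i * real (k choose i) * g i) - (\<Sum>i\<le>k. (-1) ^ i * real (k choose i) * g (Suc i))"
proof -
  have "(\<Sum>i\<le>Suc k. (-1) ^ i * real (Suc k choose i) * g i)
      = g 0 + (\<Sum>i\<le>k. (-1) ^ Suc i * real (Suc k choose Suc i) * g (Suc i))"
    by (subst sum.atMost_Suc_shift) simp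
  also have "\<dots> = g 0 + (\<Sum>i\<le>k. (-1) ^ Suc i * real (k choose Suc i) * g (Suc i))
      - (\<Sum>i\<le>k. (-1) ^ i * real (k choose i) * g (Suc i))"
    by (simp add: sum.distrib[symmetric] sum_negf[symmetric] algebra_simps sum_subtractf[symmetric])
  also have "g 0 + (\<Sum>i\<le>k. (-1) ^ Suc i * real (k choose Suc i) * g (Suc i))
      = (\<Sum>i\<le>Suc k. (-1) ^ i * real (k choose i) * g i)"
    by (subst sum.atMost_Suc_shift) simp
  finally show ?thesis by simp
qed

text \<open>
  This form, free of divisions, includes the case \<open>k = 0\<close> and thereby lets the induction
  start at the empty matrix.  The induction is over all \<open>n\<close>, as the recurrence refers to \<open>n - 1\<close>.
\<close>
lemma card_zero_diag_full_rank_mats: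
  fixes q :: real
  defines "q \<equiv> real CARD('a::{field,finite})"
  assumes "k \<le> n"
  shows "q ^ k * q_factorial q (n - k) * real (card (zero_diag_full_rank_mats k n :: 'a mat set)) =
    q ^ (k choose 2) * (q - 1) ^ k * (\<Sum>i\<le>k. (-1) ^ i * real (k choose i) * q_factorial q (n - i))"
  using \<open>k \<le> n\<close>
proof (induction k arbitrary: n)
  case 0
  have "(zero_diag_full_rank_mats 0 n :: 'a mat set) = {0\<^sub>m 0 n}"
    by (auto simp: zero_diag_full_rank_mats_eq)
  then show ?case by (simp add: binomial_eq_0)
next
  case (Suc k)
  then obtain m where n: "n = Suc m" and k: "k \<le> m" by (cases n) auto
  define F :: "nat \<Rightarrow> nat \<Rightarrow> real" where
    "F k n = real (card (zero_diag_full_rank_mats k n :: 'a mat set))" for k n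
  define S where "S k n = (\<Sum>i\<le>k. (-1) ^ i * real (k choose i) * q_factorial q (n - i))" for k n
  have q: "q > 1" using one_less_card_field[where 'a = 'a] by (simp add: q_def)
  have IH: "q ^ k * q_factorial q (Suc m - k) * F k (Suc m) = q ^ (k choose 2) * (q - 1) ^ k * S k (Suc m)"
    "q ^ k * q_factorial q (m - k) * F k m = q ^ (k choose 2) * (q - 1) ^ k * S k m"
    using Suc.IH k unfolding F_def S_def by auto
  have rec: "q * F (Suc k) (Suc m) = (q ^ Suc m - q ^ k) * F k (Suc m) - (q ^ Suc k - q ^ k) * F k m"
    using zero_diag_full_rank_mats_recurrence[OF k, where 'a = 'a] unfolding F_def q_def .
  have S: "S (Suc k) (Suc m) = S k (Suc m) - S k m"
    unfolding S_def by (subst alternating_binomial_sum_Suc) simp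
  have fact: "(q ^ Suc m - q ^ k) * q_factorial q (m - k) = q ^ k * (q - 1) * q_factorial q (Suc m - k)"
  proof -
    have split: "q ^ Suc m = q ^ k * q ^ (Suc m - k)" using k by (simp flip: power_add)
    have bracket: "(q - 1) * q_bracket q (Suc m - k) = q ^ (Suc m - k) - 1"
      using q by (simp add: q_bracket_def)
    have "q ^ Suc m - q ^ k = q ^ k * (q ^ (Suc m - k) - 1)"
      unfolding split by (simp add: right_diff_distrib del: power_Suc)
    also have "\<dots> = q ^ k * (q - 1) * q_bracket q (Suc m - k)"
      unfolding bracket[symmetric] by (simp only: mult.assoc)
    finally have "q ^ Suc m - q ^ k = q ^ k * (q - 1) * q_bracket q (Suc m - k)" .
    moreover have "q_factorial q (Suc m - k) = q_bracket q (Suc m - k) * q_factorial q (m - k)"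
      using k by (simp only: Suc_diff_le q_factorial_Suc)
    ultimately show ?thesis by (simp only: mult.assoc)
  qed
  have pow: "q ^ (Suc k choose 2) = q ^ (k choose 2) * q ^ k"
    by (simp add: numeral_2_eq_2 power_add)
  have "q ^ Suc k * q_factorial q (m - k) * F (Suc k) (Suc m)
      = q ^ k * q_factorial q (m - k) * (q * F (Suc k) (Suc m))" by simp
  also have "\<dots> = q ^ k * F k (Suc m) * ((q ^ Suc m - q ^ k) * q_factorial q (m - k))
      - q ^ k * (q - 1) * (q ^ k * q_factorial q (m - k) * F k m)"
    unfolding rec by (simp add: algebra_simps)
  also have "\<dots> = q ^ k * (q - 1) * (q ^ k * q_factorial q (Suc m - k) * F k (Suc m))
      - q ^ k * (q - 1) * (q ^ k * q_factorial q (m - k) * F k m)"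
    unfolding fact by (simp add: algebra_simps)
  also have "\<dots> = q ^ (Suc k choose 2) * (q - 1) ^ Suc k * S (Suc k) (Suc m)"
    unfolding IH S pow by (simp add: algebra_simps)
  finally show ?case unfolding n F_def S_def by simp
qed

section \<open>Invertible matrices\<close>

lemma invertible_mat_iff_det:
  fixes A :: "'a::field mat"
  assumes A: "A \<in> carrier_mat n n"
  shows "invertible_mat A \<longleftrightarrow> det A \<noteq> 0"
proof
  assume "invertible_mat A"
  then obtain B where B: "A * B = 1\<^sub>m (dim_row A)" "B * A = 1\<^sub>m (dim_row B)"
    unfolding invertible_mat_def inverts_mat_def by auto
  have "B \<in> carrier_mat n n"
    using arg_cong[OF B(1), of dim_col] arg_cong[OF B(2), of dim_col] A by (auto intro: carrier_matI)
  then have "det A * det B = 1" using B(1) A det_mult[of A n B] by simp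
  then show "det A \<noteq> 0" by auto
next
  assume "det A \<noteq> 0"
  from det_non_zero_imp_unit[OF A this]
  obtain B where "B \<in> carrier_mat n n" "A * B = 1\<^sub>m n" "B * A = 1\<^sub>m n"
    unfolding Units_def ring_mat_def by auto
  then show "invertible_mat A" using A unfolding invertible_mat_def inverts_mat_def by auto
qed

lemma zero_diag_invertible_mats_eq:
  "(zero_diag_invertible_mats n :: 'a::field mat set) = zero_diag_full_rank_mats n n"
  unfolding zero_diag_invertible_mats_def zero_diag_full_rank_mats_def
  using invertible_mat_iff_det vec_space.det_rank_iff by blast

theorem proposition2p2:
  fixes q k n :: nat
  assumes "q = CARD('a::{field,finite})" and "1 \<le> k" and "k \<le> n"
  shows
    "real (card (zero_diag_full_rank_mats k n :: 'a mat set)) =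
       real q ^ ((k - 1) choose 2) * (real q - 1) ^ k *
       (inverse (real q) *
         (\<Sum>i = 0..k. (-1) ^ i * real (k choose i) *
            (q_factorial (real q) (n - i) / q_factorial (real q) (n - k)))) \<and>
     card (zero_diag_invertible_mats n :: 'a mat set) =
       card (zero_diag_full_rank_mats n n :: 'a mat set) \<and>
     real (card (zero_diag_invertible_mats n :: 'a mat set)) =
       real q ^ ((n - 1) choose 2) * (real q - 1) ^ n *
       (inverse (real q) *
         (\<Sum>i = 0..n. (-1) ^ i * real (n choose i) * q_factorial (real q) (n - i)))"
proof -
  have q: "real q > 1" using one_less_card_field[where 'a = 'a] assms(1) by simp
  have main: "real (card (zero_diag_full_rank_mats k n :: 'a mat set)) =
       real q ^ ((k - 1) choose 2) * (real q - 1) ^ k *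
       (inverse (real q) *
         (\<Sum>i = 0..k. (-1) ^ i * real (k choose i) *
            (q_factorial (real q) (n - i) / q_factorial (real q) (n - k))))"
    if k: "1 \<le> k" "k \<le> n" for k
  proof -
    let ?S = "\<Sum>i\<le>k. (-1) ^ i * real (k choose i) * q_factorial (real q) (n - i)"
    let ?Q = "q_factorial (real q) (n - k)"
    let ?F = "real (card (zero_diag_full_rank_mats k n :: 'a mat set))"
    obtain l where l: "k = Suc l" using k by (cases k) auto
    have "real q ^ k * ?Q * ?F = real q ^ (k choose 2) * (real q - 1) ^ k * ?S"
      using card_zero_diag_full_rank_mats[OF k(2), where 'a = 'a] assms(1) by simp
    \<comment> \<open>Here \<open>k \<ge> 1\<close> matters: for \<open>k = 0\<close> the truncated \<open>k - 1\<close> would give a right-hand side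
      \<open>q\<^sup>-\<^sup>1\<close> instead of 1.\<close>
    also have "real q ^ (k choose 2) = real q ^ k * (real q ^ ((k - 1) choose 2) * inverse (real q))"
      using q l by (simp add: numeral_2_eq_2 power_add)
    finally have "?Q * ?F = real q ^ ((k - 1) choose 2) * (real q - 1) ^ k * (inverse (real q) * ?S)"
      using q by (simp add: mult.assoc mult.left_commute)
    then have "?F = real q ^ ((k - 1) choose 2) * (real q - 1) ^ k * (inverse (real q) * (?S / ?Q))"
      using q_factorial_nonzero[OF q, of "n - k"] by (simp add: nonzero_eq_divide_eq mult.commute)
    also have "?S / ?Q = (\<Sum>i = 0..k. (-1) ^ i * real (k choose i) *
        (q_factorial (real q) (n - i) / ?Q))"
      by (simp add: sum_divide_distrib atLeast0AtMost)
    finally show ?thesis .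
  qed
  have "1 \<le> n" using assms by simp
  then show ?thesis
    using main[OF assms(2,3)] main[of n] by (simp add: zero_diag_invertible_mats_eq q_factorial_def)
qed

end
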